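(* Let $n\ge 1$ be an integer. If $f:X\to Y$ is a function of metric spaces that is coarsely $n$-to-1 and coarsely surjective, and $X$ has the Metric Sparsification Property (MSP), then $Y$ has MSP.
   Context: A function $f:X\to Y$ of metric spaces is bornologous if there is a function $E:[0,\infty)\to[0,\infty)$ such that the image of every subset of $X$ of diameter at most $r$ has diameter at most $E(r)$. A bornologous function $f:X\to Y$ is coarsely $n$-to-1 (with control $C$) if there is a function $C:[0,\infty)\to[0,\infty)$ such that for each subset $B$ of $Y$ with $\mathrm{diam}(B)\le r$ one has $f^{-1}(B)=\bigcup_{i=1}^n A_i$ for some subsets $A_i$ of $X$ with $\mathrm{diam}(A_i)<C(r)$ for $i=1,\dots,n$. (In particular a coarsely $n$-to-1 function is bornologous.) For $A\subset Y$ and $R>0$, $B(A,R)$ consists of $A$ and all points at distance less than $R$ from some point of $A$. $f:X\to Y$ is coarsely surjective if $Y\subset B(f(X),R)$ for some $R>0$. A family of subsets is $R$-disjoint if $d(x,y)\ge R$ whenever $x$ and $y$ belong to different elements of the family. A metric space $X$ has MSP (Metric Sparsification Property) if for all $R>0$ and for each positive $c<1$ there exists $S>0$ such that for all probability measures $\mu$ on $X$ there exists an $R$-disjoint family $\{\Omega_i\}_{i\ge 1}$ of subsets of $X$ of diameter at most $S$ satisfying $\sum_{i=1}^\infty\mu(\Omega_i)>c$. Here probability measures on $X$ are countably additive and defined on all subsets of $X$. *)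

theory Defs
  imports "HOL-Probability.Probability"
begin

text \<open>
  A metric space is rendered as an arbitrary subset \<open>X\<close> of a type of class \<^class>\<open>metric_space\<close>,
  with the restricted metric.  This covers every metric space (take \<open>X = UNIV\<close>), including the
  empty one, which is not a type.  A function \<open>X \<rightarrow> Y\<close> is an element of \<^term>\<open>X \<rightarrow> Y\<close>.  A
  function \<open>[0,\<infinity>) \<rightarrow> [0,\<infinity>)\<close> is a real function that maps nonnegative arguments to
  nonnegative values; its values at negative arguments are never used.
\<close>

text \<open>
  The library's \<^const>\<open>diameter\<close> is real-valued, hence carries no information on unbounded
  sets, whose diameter is infinite in mathematical usage.  It is 0 on the empty set.
\<close>

definition diam_le :: "'a::metric_space set \<Rightarrow> real \<Rightarrow> bool" where
  "diam_le A r \<longleftrightarrow> bounded A \<and> diameter A \<le> r"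

definition diam_less :: "'a::metric_space set \<Rightarrow> real \<Rightarrow> bool" where
  "diam_less A r \<longleftrightarrow> bounded A \<and> diameter A < r"

definition bornologous ::
  "'a::metric_space set \<Rightarrow> 'b::metric_space set \<Rightarrow> ('a \<Rightarrow> 'b) \<Rightarrow> bool" where
  "bornologous X Y f \<longleftrightarrow> f \<in> X \<rightarrow> Y \<and>
     (\<exists>E :: real \<Rightarrow> real. (\<forall>r\<ge>0. E r \<ge> 0) \<and>
        (\<forall>r\<ge>0. \<forall>A\<subseteq>X. diam_le A r \<longrightarrow> diam_le (f ` A) (E r)))"

definition coarsely_n_to_1 ::
  "nat \<Rightarrow> 'a::metric_space set \<Rightarrow> 'b::metric_space set \<Rightarrow> ('a \<Rightarrow> 'b) \<Rightarrow> bool" where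
  "coarsely_n_to_1 n X Y f \<longleftrightarrow> bornologous X Y f \<and>
     (\<exists>C :: real \<Rightarrow> real. (\<forall>r\<ge>0. C r \<ge> 0) \<and>
        (\<forall>r\<ge>0. \<forall>B\<subseteq>Y. diam_le B r \<longrightarrow>
           (\<exists>A :: nat \<Rightarrow> 'a set. f -` B \<inter> X = (\<Union>i\<in>{1..n}. A i) \<and>
              (\<forall>i\<in>{1..n}. diam_less (A i) (C r)))))"

definition nbhd :: "'a::metric_space set \<Rightarrow> 'a set \<Rightarrow> real \<Rightarrow> 'a set" where
  "nbhd Y A R = A \<union> {y \<in> Y. \<exists>a\<in>A. dist y a < R}"

definition coarsely_surjective ::
  "'a::metric_space set \<Rightarrow> 'b::metric_space set \<Rightarrow> ('a \<Rightarrow> 'b) \<Rightarrow> bool" where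
  "coarsely_surjective X Y f \<longleftrightarrow> (\<exists>R>0. Y \<subseteq> nbhd Y (f ` X) R)"

text \<open>
  Different elements of an indexed family are elements with different indices.  If they were
  merely different sets, repeating one set would make the sum of measures below meaningless.
\<close>

definition R_disjoint :: "real \<Rightarrow> ('i \<Rightarrow> 'a::metric_space set) \<Rightarrow> bool" where
  "R_disjoint R \<Omega> \<longleftrightarrow>
     (\<forall>i j. i \<noteq> j \<longrightarrow> (\<forall>x\<in>\<Omega> i. \<forall>y\<in>\<Omega> j. dist x y \<ge> R))"

definition prob_measure_on :: "'a set \<Rightarrow> 'a measure \<Rightarrow> bool" where
  "prob_measure_on X \<mu> \<longleftrightarrow> prob_space \<mu> \<and> space \<mu> = X \<and> sets \<mu> = Pow X"

text \<open>The Metric Sparsification Property.  Families are indexed from 0.\<close>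

definition MSP :: "'a::metric_space set \<Rightarrow> bool" where
  "MSP X \<longleftrightarrow>
     (\<forall>R>0. \<forall>c::real. 0 < c \<and> c < 1 \<longrightarrow>
        (\<exists>S>0. \<forall>\<mu>. prob_measure_on X \<mu> \<longrightarrow>
           (\<exists>\<Omega> :: nat \<Rightarrow> 'a set. R_disjoint R \<Omega> \<and>
              (\<forall>i. \<Omega> i \<subseteq> X \<and> diam_le (\<Omega> i) S) \<and>
              (\<Sum>i. emeasure \<mu> (\<Omega> i)) > ennreal c)))"

end

theory Submission imports Defs begin

text \<open>
  Let \<open>s : Y \<rightarrow> X\<close> send \<open>y\<close> to a point whose image is \<open>R\<^sub>0\<close>-close to \<open>y\<close>, and apply MSP of \<open>X\<close> to the
  image measure of \<open>\<mu>\<close> under \<open>s\<close> at a large scale, obtaining sets \<open>\<Omega>\<^sub>i\<close>.  For \<open>r\<^sub>m = R\<^sub>0 + m R\<close>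
  let \<open>I\<^sub>m(y)\<close> be the set of those \<open>i\<close> for which \<open>f(\<Omega>\<^sub>i)\<close> meets the closed ball of radius \<open>r\<^sub>m\<close>
  around \<open>y\<close>.  Since \<open>f\<close> is coarsely \<open>n\<close>-to-1 and the \<open>\<Omega>\<^sub>i\<close> are far apart, \<open>I\<^sub>m(y)\<close> has at most \<open>n\<close>
  elements for all \<open>m \<le> N\<close>, so the increasing sequence \<open>I\<^sub>0(y), I\<^sub>1(y), \<dots>, I\<^sub>N(y)\<close> has at most \<open>n\<close>
  strict steps.  Averaging over \<open>m < N\<close> gives one \<open>m\<close> for which \<open>I\<^sub>m(y) = I\<^sub>m\<^sub>+\<^sub>1(y)\<close> outside a set of
  measure at most \<open>n/N\<close>.  For two such points \<open>y, y'\<close> at distance less than \<open>R\<close> one has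
  \<open>I\<^sub>m(y) \<subseteq> I\<^sub>m\<^sub>+\<^sub>1(y') = I\<^sub>m(y')\<close> and conversely, so that the level sets of \<open>min I\<^sub>m\<close> form the
  required \<open>R\<close>-disjoint family.
\<close>

text \<open>Every strict step adds at least one new element, and all of these elements end up in
  \<open>I N\<close>.\<close>

lemma card_strict_steps_le:
  fixes I :: "nat \<Rightarrow> 'a set"
  assumes "\<And>m. I m \<subseteq> I (Suc m)" "finite (I N)"
  shows "card {m. m < N \<and> I m \<noteq> I (Suc m)} \<le> card (I N)"
  using assms(2)
proof (induction N)
  case (Suc N)
  have fin: "finite (I N)"
    using Suc.prems assms(1) finite_subset by blast
  note IH = Suc.IH[OF fin]
  show ?case
  proof (cases "I N = I (Suc N)")
    case True
    then have "{m. m < Suc N \<and> I m \<noteq> I (Suc m)} = {m. m < N \<and> I m \<noteq> I (Suc m)}"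
      by (auto simp: less_Suc_eq)
    then show ?thesis using IH True by simp
  next
    case False
    then have "{m. m < Suc N \<and> I m \<noteq> I (Suc m)} = insert N {m. m < N \<and> I m \<noteq> I (Suc m)}"
      by (auto simp: less_Suc_eq)
    then have "card {m. m < Suc N \<and> I m \<noteq> I (Suc m)} \<le> Suc (card (I N))"
      using IH by simp
    also have "card (I N) < card (I (Suc N))"
      using False assms(1) Suc.prems by (intro psubset_card_mono) auto
    finally show ?thesis by simp
  qed
qed simp

text \<open>Averaging: the probabilities add up to the expected multiplicity, hence to at most
  \<open>n\<close>, so the \<open>N\<close> events cannot all exceed the mean bound.\<close>

lemma (in prob_space) exists_prob_le_of_multiplicity_le:
  fixes Z :: "nat \<Rightarrow> 'a set"
  assumes meas: "\<And>m. m < N \<Longrightarrow> Z m \<in> events"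
    and mult: "\<And>x. x \<in> space M \<Longrightarrow> card {m. m < N \<and> x \<in> Z m} \<le> n"
    and "N > 0"
  shows "\<exists>m<N. prob (Z m) \<le> real n / real N"
proof (rule ccontr)
  assume "\<not> ?thesis"
  then have gt: "real n / real N < prob (Z m)" if "m < N" for m
    using that by (auto simp: not_le)
  have "real n = (\<Sum>m<N. real n / real N)"
    using \<open>N > 0\<close> by simp
  also have "\<dots> < (\<Sum>m<N. prob (Z m))"
    using gt \<open>N > 0\<close> by (intro sum_strict_mono) auto
  also have "\<dots> = (\<Sum>m<N. expectation (indicat_real (Z m)))"
    using meas by simp
  also have "\<dots> = expectation (\<lambda>x. \<Sum>m<N. indicat_real (Z m) x)"
    using meas by (subst Bochner_Integration.integral_sum) (auto intro!: integrable_real_indicator simp: less_top[symmetric])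
  also have "\<dots> \<le> expectation (\<lambda>x. real n)"
  proof (rule integral_mono)
    show "integrable M (\<lambda>x. \<Sum>m<N. indicat_real (Z m) x)"
      using meas by (intro Bochner_Integration.integrable_sum integrable_real_indicator)
        (auto simp: less_top[symmetric])
    fix x assume "x \<in> space M"
    have "(\<Sum>m<N. indicat_real (Z m) x) = real (card {m. m < N \<and> x \<in> Z m})"
      by (simp add: indicator_def sum.If_cases Int_def)
    then show "(\<Sum>m<N. indicat_real (Z m) x) \<le> real n"
      using mult[OF \<open>x \<in> space M\<close>] by simp
  qed simp
  finally show False
    by (simp add: prob_space)
qed

text \<open>Sending \<open>i\<close> to some \<open>k\<close> for which \<open>A k\<close> meets
  \<open>\<Omega> i\<close> is injective: two indices with the same \<open>k\<close> would give
  points of \<open>A k\<close> closer than \<open>R\<close> in different members of the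
  family.\<close>

lemma card_meeting_indices_le:
  assumes disj: "R_disjoint R \<Omega>"
    and small: "\<And>k x y. k \<in> K \<Longrightarrow> x \<in> A k \<Longrightarrow> y \<in> A k \<Longrightarrow> dist x y < R"
    and "finite K"
  shows "finite {i. \<Omega> i \<inter> (\<Union>k\<in>K. A k) \<noteq> {}} \<and> card {i. \<Omega> i \<inter> (\<Union>k\<in>K. A k) \<noteq> {}} \<le> card K"
proof -
  define J where "J = {i. \<Omega> i \<inter> (\<Union>k\<in>K. A k) \<noteq> {}}"
  have "\<forall>i\<in>J. \<exists>k\<in>K. \<Omega> i \<inter> A k \<noteq> {}"
    by (auto simp: J_def)
  then obtain g where g: "\<And>i. i \<in> J \<Longrightarrow> g i \<in> K \<and> \<Omega> i \<inter> A (g i) \<noteq> {}"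
    by metis
  have inj: "inj_on g J"
  proof (rule inj_onI, rule ccontr)
    fix i j assume ij: "i \<in> J" "j \<in> J" "g i = g j" "i \<noteq> j"
    obtain x y where "x \<in> \<Omega> i" "x \<in> A (g i)" "y \<in> \<Omega> j" "y \<in> A (g i)"
      using g[OF ij(1)] g[OF ij(2)] ij(3) by auto
    then show False
      using disj small[of "g i" x y] g[OF ij(1)] ij(4) by (force simp: R_disjoint_def)
  qed
  have "g ` J \<subseteq> K" using g by auto
  then have "finite J \<and> card J \<le> card K"
    using inj \<open>finite K\<close> by (meson card_inj_on_le inj_on_finite)
  then show ?thesis by (simp add: J_def)
qed

lemma diam_leI:
  assumes "\<And>x y. x \<in> A \<Longrightarrow> y \<in> A \<Longrightarrow> dist x y \<le> d" "0 \<le> d"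
  shows "diam_le A d"
proof -
  have "bounded A"
    using assms(1) unfolding bounded_def by (metis empty_iff ex_in_conv)
  moreover have "diameter A \<le> d"
    using assms by (auto simp: diameter_def intro!: cSUP_least)
  ultimately show ?thesis by (simp add: diam_le_def)
qed

lemma diam_leD: "diam_le A d \<Longrightarrow> x \<in> A \<Longrightarrow> y \<in> A \<Longrightarrow> dist x y \<le> d"
  using diameter_bounded_bound[of A x y] by (auto simp: diam_le_def)

lemma diam_lessD: "diam_less A d \<Longrightarrow> x \<in> A \<Longrightarrow> y \<in> A \<Longrightarrow> dist x y < d"
  using diameter_bounded_bound[of A x y] by (auto simp: diam_less_def)

text \<open>As \<open>R > 0\<close>, a common point of two members would be too close to itself.
  This lets the sums in \<open>MSP\<close> be handled as measures of unions.\<close>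

lemma suminf_emeasure_R_disjoint:
  fixes \<Omega> :: "nat \<Rightarrow> 'a::metric_space set"
  assumes "R_disjoint R \<Omega>" "R > 0" "range \<Omega> \<subseteq> sets \<mu>"
  shows "(\<Sum>i. emeasure \<mu> (\<Omega> i)) = emeasure \<mu> (\<Union>i. \<Omega> i)"
proof (rule suminf_emeasure[OF assms(3)])
  have False if "i \<noteq> j" "x \<in> \<Omega> i" "x \<in> \<Omega> j" for i j x
    using assms(1,2) that by (force simp: R_disjoint_def)
  then show "disjoint_family \<Omega>"
    by (auto simp: disjoint_family_on_def)
qed

theorem theorem7p4:
  fixes X :: "'a::metric_space set" and Y :: "'b::metric_space set"
    and f :: "'a \<Rightarrow> 'b" and n :: nat
  assumes "n \<ge> 1"
    and "f \<in> X \<rightarrow> Y"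
    and "coarsely_n_to_1 n X Y f"
    and "coarsely_surjective X Y f"
    and "MSP X"
  shows "MSP Y"
  unfolding MSP_def
proof (intro allI impI)
  fix R c :: real
  assume "R > 0" and c: "0 < c \<and> c < 1"
  obtain R0 where "R0 > 0" and R0: "Y \<subseteq> nbhd Y (f ` X) R0"
    using assms(4) by (auto simp: coarsely_surjective_def)
  have "\<forall>y\<in>Y. \<exists>x\<in>X. dist (f x) y \<le> R0"
    using R0 \<open>R0 > 0\<close> by (force simp: nbhd_def dist_commute)
  then obtain s where s: "\<And>y. y \<in> Y \<Longrightarrow> s y \<in> X" "\<And>y. y \<in> Y \<Longrightarrow> dist (f (s y)) y \<le> R0"
    by metis
  obtain E where E: "\<And>r. r \<ge> 0 \<Longrightarrow> E r \<ge> 0"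
      "\<And>r A. r \<ge> 0 \<Longrightarrow> A \<subseteq> X \<Longrightarrow> diam_le A r \<Longrightarrow> diam_le (f ` A) (E r)"
    using assms(3) unfolding coarsely_n_to_1_def bornologous_def by metis
  obtain C where C0: "\<And>r. r \<ge> 0 \<Longrightarrow> C r \<ge> 0"
      and C: "\<And>r B. r \<ge> 0 \<Longrightarrow> B \<subseteq> Y \<Longrightarrow> diam_le B r \<Longrightarrow>
        \<exists>A :: nat \<Rightarrow> 'a set. f -` B \<inter> X = (\<Union>i\<in>{1..n}. A i) \<and> (\<forall>i\<in>{1..n}. diam_less (A i) (C r))"
    using assms(3) unfolding coarsely_n_to_1_def by metis
  \<comment> \<open>MSP of \<open>X\<close> is applied with the midpoint \<open>c'\<close>. The gap
    \<open>c' - c\<close> pays for the exceptional set, of measure at most \<open>n / N\<close>, and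
    dictates the choice of \<open>N\<close>.\<close>
  define c' where "c' = (1 + c) / 2"
  have c': "0 < c'" "c' < 1" "c < c'"
    using c by (auto simp: c'_def)
  obtain N :: nat where N: "real n / (c' - c) < real N"
    using reals_Archimedean2 by blast
  have "N > 0"
  proof (rule ccontr)
    assume "\<not> N > 0"
    then have "real n / (c' - c) < 0" using N by simp
    then show False using c' by (simp add: divide_less_0_iff)
  qed
  have nN: "real n / real N < c' - c"
    using N c' \<open>N > 0\<close> by (simp add: field_simps)
  define r where "r m = R0 + real m * R" for m :: nat
  have r0: "r m \<ge> 0" for m
    using \<open>R0 > 0\<close> \<open>R > 0\<close> by (simp add: r_def)
  have r_mono: "r m \<le> r k" if "m \<le> k" for m k
    using that \<open>R > 0\<close> by (simp add: r_def)
  \<comment> \<open>A closed ball of radius \<open>r N\<close> has diameter at most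
    \<open>2 * r N\<close>, so its preimage is a union of \<open>n\<close> sets of diameter below
    \<open>C (2 * r N)\<close>; each of these meets at most one member of an
    \<open>R'\<close>-disjoint family. The summand 1 makes \<open>R'\<close> positive even where
    \<open>C\<close> vanishes.\<close>
  define R' where "R' = C (2 * r N) + 1"
  have "R' > 0"
    using C0[of "2 * r N"] r0[of N] by (simp add: R'_def)
  then obtain S where "S > 0" and S: "\<And>\<mu>. prob_measure_on X \<mu> \<Longrightarrow>
      \<exists>\<Omega> :: nat \<Rightarrow> 'a set. R_disjoint R' \<Omega> \<and> (\<forall>i. \<Omega> i \<subseteq> X \<and> diam_le (\<Omega> i) S) \<and>
         (\<Sum>i. emeasure \<mu> (\<Omega> i)) > ennreal c'"
    using assms(5) c' unfolding MSP_def by meson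
  \<comment> \<open>Two points of one level set both lie within \<open>r N\<close> of the image of a
    single \<open>\<Omega> i\<close>, which has diameter at most \<open>E S\<close>.\<close>
  define S' where "S' = E S + 2 * r N"
  have ES: "E S \<ge> 0" using E(1) \<open>S > 0\<close> by simp
  have "S' > 0"
    using ES \<open>R0 > 0\<close> \<open>R > 0\<close> by (simp add: S'_def r_def add_nonneg_pos add_pos_nonneg)
  show "\<exists>S>0. \<forall>\<mu>. prob_measure_on Y \<mu> \<longrightarrow>
           (\<exists>\<Omega> :: nat \<Rightarrow> 'b set. R_disjoint R \<Omega> \<and> (\<forall>i. \<Omega> i \<subseteq> Y \<and> diam_le (\<Omega> i) S) \<and>
              (\<Sum>i. emeasure \<mu> (\<Omega> i)) > ennreal c)"
  proof (intro exI[of _ S'] conjI allI impI \<open>S' > 0\<close>)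
    fix \<mu> :: "'b measure" assume \<mu>: "prob_measure_on Y \<mu>"
    then interpret prob_space \<mu> by (simp add: prob_measure_on_def)
    have sp: "space \<mu> = Y" and se: "sets \<mu> = Pow Y"
      using \<mu> by (auto simp: prob_measure_on_def)
    have s_meas: "s \<in> \<mu> \<rightarrow>\<^sub>M count_space X"
      using s(1) by (auto simp: measurable_def sp se)
    define \<nu> where "\<nu> = distr \<mu> (count_space X) s"
    have "prob_measure_on X \<nu>"
      using prob_space_distr[OF s_meas] by (simp add: prob_measure_on_def \<nu>_def)
    from S[OF this] obtain \<Omega> :: "nat \<Rightarrow> 'a set" where disj: "R_disjoint R' \<Omega>"
      and \<Omega>: "\<And>i. \<Omega> i \<subseteq> X" "\<And>i. diam_le (\<Omega> i) S"
      and sum: "(\<Sum>i. emeasure \<nu> (\<Omega> i)) > ennreal c'"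
      by blast
    define Y' where "Y' = {y\<in>Y. s y \<in> (\<Union>i. \<Omega> i)}"
    have "(\<Sum>i. emeasure \<nu> (\<Omega> i)) = emeasure \<nu> (\<Union>i. \<Omega> i)"
      using \<Omega>(1) by (intro suminf_emeasure_R_disjoint[OF disj \<open>R' > 0\<close>]) (auto simp: \<nu>_def)
    also have "\<dots> = emeasure \<mu> (s -` (\<Union>i. \<Omega> i) \<inter> space \<mu>)"
      unfolding \<nu>_def using \<Omega>(1) by (intro emeasure_distr[OF s_meas]) auto
    also have "s -` (\<Union>i. \<Omega> i) \<inter> space \<mu> = Y'"
      by (auto simp: Y'_def sp)
    finally have Y'_prob: "prob Y' > c'"
      using sum c' by (simp add: emeasure_eq_measure ennreal_less_iff)
    define I where "I m y = {i. \<exists>x\<in>\<Omega> i. dist (f x) y \<le> r m}" for m y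
    have I_mono: "I m y \<subseteq> I k y" if "m \<le> k" for m k y
      using r_mono[OF that] by (force simp: I_def)
    have I_card: "finite (I N y) \<and> card (I N y) \<le> n" if "y \<in> Y" for y
    proof -
      define B where "B = {z\<in>Y. dist z y \<le> r N}"
      have "diam_le B (2 * r N)"
      proof (rule diam_leI)
        fix u v assume "u \<in> B" "v \<in> B"
        then show "dist u v \<le> 2 * r N"
          using dist_triangle2[of u v y] by (simp add: B_def)
      qed (use r0[of N] in simp)
      then obtain A :: "nat \<Rightarrow> 'a set" where A: "f -` B \<inter> X = (\<Union>i\<in>{1..n}. A i)"
          "\<And>i. i\<in>{1..n} \<Longrightarrow> diam_less (A i) (C (2 * r N))"
        using C[of "2 * r N" B] r0[of N] by (auto simp: B_def)
      have "I N y = {i. \<Omega> i \<inter> (f -` B \<inter> X) \<noteq> {}}"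
        using \<Omega>(1) assms(2) by (fastforce simp: I_def B_def)
      moreover have "dist u v < R'" if "i \<in> {1..n}" "u \<in> A i" "v \<in> A i" for i u v
        using diam_lessD[OF A(2)[OF that(1)] that(2,3)] by (simp add: R'_def)
      ultimately show ?thesis
        using card_meeting_indices_le[OF disj, of "{1..n}" A] unfolding A(1) by simp
    qed
    have I_nonempty: "I m y \<noteq> {}" if y: "y \<in> Y'" for m y
    proof -
      obtain i where "s y \<in> \<Omega> i" "y \<in> Y" using y by (auto simp: Y'_def)
      \<comment> \<open>The point \<open>s y\<close> itself witnesses membership, because the radii
        start at \<open>r 0 = R0\<close>.\<close>
      moreover have "R0 \<le> r m" using r_mono[of 0 m] by (simp add: r_def)
      ultimately show ?thesis using s(2)[of y] by (force simp: I_def)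
    qed
    have I_shift: "I m y \<subseteq> I (Suc m) z" if "dist y z < R" for m y z
    proof
      fix i assume "i \<in> I m y"
      then obtain x where x: "x \<in> \<Omega> i" "dist (f x) y \<le> r m" by (auto simp: I_def)
      \<comment> \<open>Consecutive radii differ by exactly \<open>R\<close>, which absorbs the move
        from \<open>y\<close> to \<open>z\<close>.\<close>
      have "dist (f x) z \<le> r (Suc m)"
        using dist_triangle[of "f x" z y] x(2) that by (simp add: r_def algebra_simps)
      then show "i \<in> I (Suc m) z" using x by (auto simp: I_def)
    qed
    define Z where "Z m = {y\<in>Y. I m y \<noteq> I (Suc m) y}" for m
    have "\<exists>m<N. prob (Z m) \<le> real n / real N"
    proof (rule exists_prob_le_of_multiplicity_le)
      fix y assume "y \<in> space \<mu>"
      then have "y \<in> Y" by (simp add: sp)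
      then have "card {m. m < N \<and> y \<in> Z m} \<le> card (I N y)"
        using card_strict_steps_le[of "\<lambda>m. I m y" N, OF I_mono] I_card by (simp add: Z_def)
      also have "\<dots> \<le> n" using I_card \<open>y \<in> Y\<close> by simp
      finally show "card {m. m < N \<and> y \<in> Z m} \<le> n" .
    qed (auto simp: Z_def se \<open>N > 0\<close>)
    then obtain m where m: "m < N" "prob (Z m) \<le> real n / real N" by blast
    \<comment> \<open>For \<open>y\<close> in \<open>Y'\<close> and \<open>m < N\<close> the set
      \<open>I m y\<close> is nonempty and finite, so its minimum is an actual member. The label
      \<open>i\<close> thus names a set \<open>\<Omega> i\<close> whose image comes near
      \<open>y\<close>, which is what bounds the diameter of \<open>\<Omega>' i\<close>.\<close>
    define \<Omega>' where "\<Omega>' i = {y \<in> Y' - Z m. Min (I m y) = i}" for i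
    have \<Omega>'Y: "\<Omega>' i \<subseteq> Y" for i
      by (auto simp: \<Omega>'_def Y'_def)
    have \<Omega>'disj: "R_disjoint R \<Omega>'"
      unfolding R_disjoint_def
    proof (intro allI impI ballI, rule ccontr)
      fix i j y z assume ij: "i \<noteq> j" and y: "y \<in> \<Omega>' i" and z: "z \<in> \<Omega>' j" and "\<not> R \<le> dist y z"
      then have d: "dist y z < R" "dist z y < R" by (auto simp: dist_commute)
      have "I m y = I (Suc m) y" "I m z = I (Suc m) z"
        using y z by (auto simp: \<Omega>'_def Z_def Y'_def)
      then have "I m y = I m z"
        using I_shift[OF d(1), of m] I_shift[OF d(2), of m] by blast
      then show False using ij y z by (simp add: \<Omega>'_def)
    qed
    have \<Omega>'diam: "diam_le (\<Omega>' i) S'" for i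
    proof (rule diam_leI)
      have near: "\<exists>x\<in>\<Omega> i. dist (f x) y \<le> r N" if y: "y \<in> \<Omega>' i" for y
      proof -
        have "y \<in> Y'" "y \<in> Y" using y by (auto simp: \<Omega>'_def Y'_def)
        have "I m y \<subseteq> I N y" using I_mono m(1) by simp
        then have "finite (I m y)" using I_card[OF \<open>y \<in> Y\<close>] finite_subset by blast
        then have "Min (I m y) \<in> I m y" using I_nonempty[OF \<open>y \<in> Y'\<close>] by (rule Min_in)
        then have "i \<in> I N y"
          using \<open>I m y \<subseteq> I N y\<close> y by (auto simp: \<Omega>'_def)
        then show ?thesis by (simp add: I_def)
      qed
      fix y z assume "y \<in> \<Omega>' i" "z \<in> \<Omega>' i"
      then obtain u v where u: "u \<in> \<Omega> i" "dist (f u) y \<le> r N" and v: "v \<in> \<Omega> i" "dist (f v) z \<le> r N"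
        using near by meson
      have "dist (f u) (f v) \<le> E S"
        using E(2)[of S "\<Omega> i"] \<Omega> \<open>S > 0\<close> u(1) v(1) by (intro diam_leD[of "f ` \<Omega> i"]) auto
      then show "dist y z \<le> S'"
        using u(2) v(2) dist_triangle[of y z "f u"] dist_triangle[of "f u" z "f v"]
        by (simp add: S'_def dist_commute)
    qed (use \<open>S' > 0\<close> in simp)
    have "c < c' - real n / real N" using nN by simp
    also have "\<dots> < prob Y' - prob (Z m)" using Y'_prob m(2) by simp
    also have "\<dots> \<le> prob (Y' - Z m)"
    proof -
      have "prob Y' \<le> prob ((Y' - Z m) \<union> Z m)"
        by (intro finite_measure_mono) (auto simp: se Y'_def Z_def)
      also have "\<dots> \<le> prob (Y' - Z m) + prob (Z m)"
        by (intro measure_Un_le) (auto simp: se Y'_def Z_def)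
      finally show ?thesis by simp
    qed
    also have "Y' - Z m = (\<Union>i. \<Omega>' i)"
      by (auto simp: \<Omega>'_def)
    finally have "ennreal c < emeasure \<mu> (\<Union>i. \<Omega>' i)"
      using c by (simp add: emeasure_eq_measure ennreal_less_iff)
    also have "\<dots> = (\<Sum>i. emeasure \<mu> (\<Omega>' i))"
      using \<Omega>'Y by (intro suminf_emeasure_R_disjoint[OF \<Omega>'disj \<open>R > 0\<close>, symmetric]) (auto simp: se)
    finally show "\<exists>\<Omega> :: nat \<Rightarrow> 'b set. R_disjoint R \<Omega> \<and> (\<forall>i. \<Omega> i \<subseteq> Y \<and> diam_le (\<Omega> i) S') \<and>
        (\<Sum>i. emeasure \<mu> (\<Omega> i)) > ennreal c"
      using \<Omega>'Y \<Omega>'disj \<Omega>'diam by blast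
  qed
qed

end
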